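(* Let $H$ be a weighted graph with weight function $\mathrm{wt}$ on its edges, and let $G$ be a cellular completion of $H$. Let $H'$ be the complement of $H$ with respect to $G$, equipped with the derived weight $\mathrm{wt}'$. Then $$ M(H;\mathrm{wt})=2^{|\mathcal C_0|}\left(\prod_{c\in\mathcal C_1}\Delta(c)\right)M(H';\mathrm{wt}'), $$ where $\mathcal C_1$ and $\mathcal C_0$ are the sets of whole and partial cells, respectively.
   Context: All graphs are finite. The weight of a perfect matching of a weighted graph is the product of the weights of its edges, and the matching generating function $M(G;\mathrm{wt})$ is the sum of the weights of all perfect matchings. A cellular graph is a finite graph $G$ whose edge set is partitioned into 4-cycles (the cells of $G$) such that each vertex is contained in at most two cells; every vertex is assumed to lie in at least one cell. The set $X(G)$ of extremal vertices of $G$ is the set of vertices contained in exactly one cell (these are the vertices at which the lines of cells, obtained by passing repeatedly to the opposite vertex of a cell and then to the other cell containing that vertex, terminate). Given a weighted graph $H$, a weighted cellular graph $G$ is a cellular completion of $H$ if (i) $H$ is a (weighted) subgraph of $G$, and all edges of $E(G)\setminus E(H)$ with both endpoints in $V(H)$ have weight $0$ in $G$; and (ii) $V(G)\setminus V(H)\subseteq X(G)$. The weights of the edges of $H$ are independent indeterminates, and everything takes place in the field of rational functions in them. For a cell $c$ of $G$, consider the set of endpoints of those edges of $H$ that are contained in $c$. The cell is called whole if this set consists of all four vertices of $c$, and partial otherwise. Standing assumptions: each cell of $G$ contains at least one edge of $H$, and each vertex of a cell $c$ that belongs to $V(H)$ is an endpoint of some edge of $H$ contained in $c$. If the whole cell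 $c$ has edges weighted $x,y,z,w$ in cyclic order (edges of $c$ not in $H$ have weight $0$), its cell-factor is $\Delta(c)=xz+yw$, which is nonzero. The complement $H'$ of $H$ with respect to $G$ is the induced subgraph of $G$ whose vertex set is the symmetric difference $V(H')=V(H)\,\triangle\,X(G)$. Define a new weight $\mathrm{wt}_1$ on the edges of $G$, cell by cell. If $c$ is whole, then for each edge $e$ of $c$ set $\mathrm{wt}_1(e)=\mathrm{wt}(f)/\Delta(c)$, where $f$ is the edge opposite $e$ in $c$. If $c$ is a partial cell with vertices $A,B,C,D$ in cyclic order, whose edges in $H$ are $AB$ of weight $x$ and $BC$ of weight $y$ (so $D\notin V(H)$), set $\mathrm{wt}_1(AB)=\frac{1}{2x}$, $\mathrm{wt}_1(BC)=\frac1{2y}$, $\mathrm{wt}_1(CD)=\frac x2$, $\mathrm{wt}_1(DA)=\frac y2$. If $c$ is a partial cell with vertices $A,B,C,D$ in cyclic order, whose only edge in $H$ is $AB$, of weight $x$ (so $C,D\notin V(H)$), set $\mathrm{wt}_1(AB)=\frac1{2x}$, $\mathrm{wt}_1(CD)=\frac x2$, $\mathrm{wt}_1(BC)=\mathrm{wt}_1(DA)=\frac12$. The derived weight $\mathrm{wt}'$ on $H'$ is the restriction of $\mathrm{wt}_1$ to the edges of $H'$ (edges of weight $0$ contribute nothing to $M(H';\mathrm{wt}')$). *)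

theory Defs
  imports
    "HOL-Library.Disjoint_Sets"
    "HOL-Library.Poly_Mapping"
    "HOL-Computational_Algebra.Fraction_Field"
begin

section \<open>Graphs and perfect matchings\<close>

text \<open>Undirected, loopless graphs, with named edges so that parallel edges are allowed;
  simple graphs are those whose map \<open>ends\<close> is injective on the edges.\<close>

record ('v, 'e) ugraph =
  verts :: "'v set"
  edges :: "'e set"
  ends :: "'e \<Rightarrow> 'v set"

definition finite_graph :: "('v, 'e) ugraph \<Rightarrow> bool" where
  "finite_graph G \<longleftrightarrow>
     finite (verts G) \<and> finite (edges G) \<and>
     (\<forall>e\<in>edges G. ends G e \<subseteq> verts G \<and> card (ends G e) = 2)"

definition subgraph :: "('v, 'e) ugraph \<Rightarrow> ('v, 'e) ugraph \<Rightarrow> bool" where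
  "subgraph H G \<longleftrightarrow>
     finite_graph H \<and> finite_graph G \<and> verts H \<subseteq> verts G \<and> edges H \<subseteq> edges G \<and>
     (\<forall>e\<in>edges H. ends H e = ends G e)"

definition induced_subgraph :: "('v, 'e) ugraph \<Rightarrow> 'v set \<Rightarrow> ('v, 'e) ugraph" where
  "induced_subgraph G W =
     \<lparr>verts = W, edges = {e \<in> edges G. ends G e \<subseteq> W}, ends = ends G\<rparr>"

definition covered :: "('v, 'e) ugraph \<Rightarrow> 'e set \<Rightarrow> 'v set" where
  "covered G F = (\<Union>e\<in>F. ends G e)"

definition perfect_matching :: "('v, 'e) ugraph \<Rightarrow> 'e set \<Rightarrow> bool" where
  "perfect_matching G M \<longleftrightarrow>
     M \<subseteq> edges G \<and> (\<forall>v\<in>verts G. \<exists>!e. e \<in> M \<and> v \<in> ends G e)"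

definition matching_gf :: "('v, 'e) ugraph \<Rightarrow> ('e \<Rightarrow> 'k::comm_semiring_1) \<Rightarrow> 'k" where
  "matching_gf G wt = (\<Sum>M | perfect_matching G M. \<Prod>e\<in>M. wt e)"


section \<open>Cellular graphs\<close>

text \<open>\<open>A, B, C, D\<close> are the vertices of a 4-cycle in cyclic order, and \<open>e1, e2, e3, e4\<close> are its
  edges \<open>AB, BC, CD, DA\<close>.\<close>

definition four_cycle ::
  "('v, 'e) ugraph \<Rightarrow> 'v \<Rightarrow> 'v \<Rightarrow> 'v \<Rightarrow> 'v \<Rightarrow> 'e \<Rightarrow> 'e \<Rightarrow> 'e \<Rightarrow> 'e \<Rightarrow> bool" where
  "four_cycle G A B C D e1 e2 e3 e4 \<longleftrightarrow>
     distinct [A, B, C, D] \<and> {e1, e2, e3, e4} \<subseteq> edges G \<and>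
     ends G e1 = {A, B} \<and> ends G e2 = {B, C} \<and> ends G e3 = {C, D} \<and> ends G e4 = {D, A}"

text \<open>A cell is identified with its set of edges; its vertices are \<open>covered G c\<close>.\<close>

definition cells_at :: "('v, 'e) ugraph \<Rightarrow> 'e set set \<Rightarrow> 'v \<Rightarrow> 'e set set" where
  "cells_at G \<C> v = {c \<in> \<C>. v \<in> covered G c}"

definition cellular_graph :: "('v, 'e) ugraph \<Rightarrow> 'e set set \<Rightarrow> bool" where
  "cellular_graph G \<C> \<longleftrightarrow>
     finite_graph G \<and>
     partition_on (edges G) \<C> \<and>
     (\<forall>c\<in>\<C>. \<exists>A B C D e1 e2 e3 e4.
        four_cycle G A B C D e1 e2 e3 e4 \<and> c = {e1, e2, e3, e4}) \<and>
     (\<forall>v\<in>verts G. 1 \<le> card (cells_at G \<C> v) \<and> card (cells_at G \<C> v) \<le> 2)"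

definition extremal_verts :: "('v, 'e) ugraph \<Rightarrow> 'e set set \<Rightarrow> 'v set" where
  "extremal_verts G \<C> = {v \<in> verts G. card (cells_at G \<C> v) = 1}"


section \<open>Cellular completions\<close>

definition cellular_completion ::
  "('v, 'e) ugraph \<Rightarrow> 'e set set \<Rightarrow> ('e \<Rightarrow> 'k::zero) \<Rightarrow> ('v, 'e) ugraph \<Rightarrow> ('e \<Rightarrow> 'k) \<Rightarrow> bool" where
  "cellular_completion G \<C> wt\<^sub>G H wt\<^sub>H \<longleftrightarrow>
     cellular_graph G \<C> \<and>
     subgraph H G \<and>
     (\<forall>e\<in>edges H. wt\<^sub>G e = wt\<^sub>H e) \<and>
     (\<forall>e\<in>edges G - edges H. ends G e \<subseteq> verts H \<longrightarrow> wt\<^sub>G e = 0) \<and>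
     verts G - verts H \<subseteq> extremal_verts G \<C>"

text \<open>The standing assumptions on the position of \<open>H\<close> relative to the cells of \<open>G\<close>.\<close>

definition cells_meet :: "('v, 'e) ugraph \<Rightarrow> 'e set set \<Rightarrow> ('v, 'e) ugraph \<Rightarrow> bool" where
  "cells_meet G \<C> H \<longleftrightarrow>
     (\<forall>c\<in>\<C>. c \<inter> edges H \<noteq> {} \<and> covered G c \<inter> verts H \<subseteq> covered G (c \<inter> edges H))"

definition whole_cell :: "('v, 'e) ugraph \<Rightarrow> ('v, 'e) ugraph \<Rightarrow> 'e set \<Rightarrow> bool" where
  "whole_cell G H c \<longleftrightarrow> covered G (c \<inter> edges H) = covered G c"

definition whole_cells :: "('v, 'e) ugraph \<Rightarrow> 'e set set \<Rightarrow> ('v, 'e) ugraph \<Rightarrow> 'e set set" where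
  "whole_cells G \<C> H = {c \<in> \<C>. whole_cell G H c}"

definition partial_cells :: "('v, 'e) ugraph \<Rightarrow> 'e set set \<Rightarrow> ('v, 'e) ugraph \<Rightarrow> 'e set set" where
  "partial_cells G \<C> H = {c \<in> \<C>. \<not> whole_cell G H c}"

definition complement_graph ::
  "('v, 'e) ugraph \<Rightarrow> 'e set set \<Rightarrow> ('v, 'e) ugraph \<Rightarrow> ('v, 'e) ugraph" where
  "complement_graph G \<C> H =
     induced_subgraph G (sym_diff (verts H) (extremal_verts G \<C>))"


section \<open>Cell-factors and the derived weight\<close>

text \<open>The value \<open>xz + yw\<close> does not depend on the cyclic labelling of the cell;
  see \<open>cell_factor_eq\<close> below.\<close>

definition cell_factor :: "('v, 'e) ugraph \<Rightarrow> ('e \<Rightarrow> 'k::comm_semiring_1) \<Rightarrow> 'e set \<Rightarrow> 'k" where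
  "cell_factor G wt c =
     (THE d. \<exists>A B C D e1 e2 e3 e4.
        four_cycle G A B C D e1 e2 e3 e4 \<and> c = {e1, e2, e3, e4} \<and>
        d = wt e1 * wt e3 + wt e2 * wt e4)"

definition opposite_edge :: "('v, 'e) ugraph \<Rightarrow> 'e set \<Rightarrow> 'e \<Rightarrow> 'e" where
  "opposite_edge G c e = (THE f. f \<in> c \<and> ends G f \<inter> ends G e = {})"

definition cell_of :: "'e set set \<Rightarrow> 'e \<Rightarrow> 'e set" where
  "cell_of \<C> e = (THE c. c \<in> \<C> \<and> e \<in> c)"

text \<open>The last three branches treat both kinds of partial cells (two adjacent edges in \<open>H\<close>, or
  one edge in \<open>H\<close>) at once; the resulting values are spelled out in \<open>derived_weight_two\<close> and
  \<open>derived_weight_one\<close> below.\<close>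

definition derived_weight ::
  "('v, 'e) ugraph \<Rightarrow> 'e set set \<Rightarrow> ('e \<Rightarrow> 'k::field) \<Rightarrow> ('v, 'e) ugraph \<Rightarrow> 'e \<Rightarrow> 'k" where
  "derived_weight G \<C> wt H e =
     (let c = cell_of \<C> e; f = opposite_edge G c e in
      if whole_cell G H c then wt f / cell_factor G wt c
      else if e \<in> edges H then 1 / (2 * wt e)
      else if f \<in> edges H then wt f / 2
      else 1 / 2)"

lemma four_cycle_distinct_edges:
  assumes "four_cycle G A B C D e1 e2 e3 e4"
  shows "distinct [e1, e2, e3, e4]"
proof -
  have "distinct [{A, B}, {B, C}, {C, D}, {D, A}]"
    using assms by (auto simp: four_cycle_def doubleton_eq_iff)
  then have "distinct (map (ends G) [e1, e2, e3, e4])"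
    using assms by (simp add: four_cycle_def)
  then show ?thesis
    using distinct_map by blast
qed

lemma four_cycle_opposite:
  assumes cyc: "four_cycle G A B C D e1 e2 e3 e4" and c: "c = {e1, e2, e3, e4}"
  shows "opposite_edge G c e1 = e3" "opposite_edge G c e2 = e4"
    "opposite_edge G c e3 = e1" "opposite_edge G c e4 = e2"
proof -
  have ends: "ends G e1 = {A, B}" "ends G e2 = {B, C}" "ends G e3 = {C, D}" "ends G e4 = {D, A}"
    and ne: "A \<noteq> B" "A \<noteq> C" "A \<noteq> D" "B \<noteq> C" "B \<noteq> D" "C \<noteq> D"
    using cyc by (simp_all add: four_cycle_def)
  have *: "opposite_edge G c e = f"
    if "f \<in> c" "ends G f \<inter> ends G e = {}"
      and "\<forall>g\<in>c. g \<noteq> f \<longrightarrow> ends G g \<inter> ends G e \<noteq> {}" for e f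
    unfolding opposite_edge_def by (rule the_equality) (use that in blast)+
  show "opposite_edge G c e1 = e3" by (rule *) (use ends ne c in simp_all)
  show "opposite_edge G c e2 = e4" by (rule *) (use ends ne c in simp_all)
  show "opposite_edge G c e3 = e1" by (rule *) (use ends ne c in simp_all)
  show "opposite_edge G c e4 = e2" by (rule *) (use ends ne c in simp_all)
qed

lemma cell_factor_eq:
  fixes wt :: "'e \<Rightarrow> 'k::comm_semiring_1"
  assumes cyc: "four_cycle G A B C D e1 e2 e3 e4" and c: "c = {e1, e2, e3, e4}"
  shows "cell_factor G wt c = wt e1 * wt e3 + wt e2 * wt e4"
  unfolding cell_factor_def
proof (rule the_equality)
  show "\<exists>A B C D e1' e2' e3' e4'. four_cycle G A B C D e1' e2' e3' e4' \<and>
      c = {e1', e2', e3', e4'} \<and>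
      wt e1 * wt e3 + wt e2 * wt e4 = wt e1' * wt e3' + wt e2' * wt e4'"
    using cyc c by blast
next
  fix d
  assume "\<exists>A B C D e1 e2 e3 e4. four_cycle G A B C D e1 e2 e3 e4 \<and>
      c = {e1, e2, e3, e4} \<and> d = wt e1 * wt e3 + wt e2 * wt e4"
  then obtain A' B' C' D' f1 f2 f3 f4 where
    cyc': "four_cycle G A' B' C' D' f1 f2 f3 f4" and c': "c = {f1, f2, f3, f4}" and
    d: "d = wt f1 * wt f3 + wt f2 * wt f4"
    by blast
  note opp = four_cycle_opposite[OF cyc c] and opp' = four_cycle_opposite[OF cyc' c']
  have f: "f1 \<in> {e1, e2, e3, e4}" "f2 \<in> {e1, e2, e3, e4}"
    using c c' by auto
  have ne: "f2 \<noteq> f1" "f2 \<noteq> opposite_edge G c f1"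
    using four_cycle_distinct_edges[OF cyc'] opp' by auto
  have "d = wt f1 * wt (opposite_edge G c f1) + wt f2 * wt (opposite_edge G c f2)"
    by (simp add: d opp')
  moreover have "\<dots> = wt e1 * wt e3 + wt e2 * wt e4"
    using f ne by (elim insertE emptyE) (simp_all add: opp ac_simps)
  ultimately show "d = wt e1 * wt e3 + wt e2 * wt e4"
    by simp
qed

lemma cell_of_eq:
  assumes "cellular_graph G \<C>" "c \<in> \<C>" "e \<in> c"
  shows "cell_of \<C> e = c"
  unfolding cell_of_def
proof (rule the_equality)
  show "c \<in> \<C> \<and> e \<in> c" using assms by simp
  show "d = c" if "d \<in> \<C> \<and> e \<in> d" for d
  proof (rule ccontr)
    assume "d \<noteq> c"
    have "disjoint \<C>"
      using assms(1) by (simp add: cellular_graph_def partition_on_def)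
    then have "d \<inter> c = {}"
      using that assms(2) \<open>d \<noteq> c\<close> by (simp add: disjointD)
    then show False
      using that assms(3) by blast
  qed
qed

lemma derived_weight_whole:
  assumes "cellular_graph G \<C>" "c \<in> \<C>" "whole_cell G H c" "e \<in> c"
  shows "derived_weight G \<C> wt H e = wt (opposite_edge G c e) / cell_factor G wt c"
  using assms by (simp add: derived_weight_def cell_of_eq[OF assms(1,2,4)])

lemma derived_weight_two:
  assumes "cellular_graph G \<C>" "c \<in> \<C>"
    and cyc: "four_cycle G A B C D e1 e2 e3 e4" and c: "c = {e1, e2, e3, e4}"
    and H: "c \<inter> edges H = {e1, e2}"
  shows "derived_weight G \<C> wt H e1 = 1 / (2 * wt e1)"
    and "derived_weight G \<C> wt H e2 = 1 / (2 * wt e2)"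
    and "derived_weight G \<C> wt H e3 = wt e1 / 2"
    and "derived_weight G \<C> wt H e4 = wt e2 / 2"
proof -
  have nw: "\<not> whole_cell G H c"
  proof -
    have "D \<in> covered G c"
      using cyc by (simp add: c covered_def four_cycle_def)
    moreover have "D \<notin> covered G (c \<inter> edges H)"
      using cyc unfolding H by (auto simp: covered_def four_cycle_def)
    ultimately show ?thesis
      unfolding whole_cell_def by blast
  qed
  have cell: "cell_of \<C> e = c" if "e \<in> c" for e
    by (rule cell_of_eq[OF assms(1,2) that])
  have cells: "cell_of \<C> e1 = c" "cell_of \<C> e2 = c" "cell_of \<C> e3 = c" "cell_of \<C> e4 = c"
    by (rule cell, simp add: c)+
  have "e1 \<in> edges H" "e2 \<in> edges H" using H by auto
  moreover have "e3 \<notin> edges H" "e4 \<notin> edges H"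
    using H c four_cycle_distinct_edges[OF cyc] by auto
  ultimately show "derived_weight G \<C> wt H e1 = 1 / (2 * wt e1)"
    "derived_weight G \<C> wt H e2 = 1 / (2 * wt e2)"
    "derived_weight G \<C> wt H e3 = wt e1 / 2"
    "derived_weight G \<C> wt H e4 = wt e2 / 2"
    using nw four_cycle_opposite[OF cyc c] cells
    by (simp_all add: derived_weight_def)
qed

lemma derived_weight_one:
  assumes "cellular_graph G \<C>" "c \<in> \<C>"
    and cyc: "four_cycle G A B C D e1 e2 e3 e4" and c: "c = {e1, e2, e3, e4}"
    and H: "c \<inter> edges H = {e1}"
  shows "derived_weight G \<C> wt H e1 = 1 / (2 * wt e1)"
    and "derived_weight G \<C> wt H e3 = wt e1 / 2"
    and "derived_weight G \<C> wt H e2 = 1 / 2"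
    and "derived_weight G \<C> wt H e4 = 1 / 2"
proof -
  have nw: "\<not> whole_cell G H c"
  proof -
    have "D \<in> covered G c"
      using cyc by (simp add: c covered_def four_cycle_def)
    moreover have "D \<notin> covered G (c \<inter> edges H)"
      using cyc unfolding H by (auto simp: covered_def four_cycle_def)
    ultimately show ?thesis
      unfolding whole_cell_def by blast
  qed
  have cell: "cell_of \<C> e = c" if "e \<in> c" for e
    by (rule cell_of_eq[OF assms(1,2) that])
  have cells: "cell_of \<C> e1 = c" "cell_of \<C> e2 = c" "cell_of \<C> e3 = c" "cell_of \<C> e4 = c"
    by (rule cell, simp add: c)+
  have "e1 \<in> edges H" using H by auto
  moreover have "e2 \<notin> edges H" "e3 \<notin> edges H" "e4 \<notin> edges H"
    using H c four_cycle_distinct_edges[OF cyc] by auto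
  ultimately show "derived_weight G \<C> wt H e1 = 1 / (2 * wt e1)"
    "derived_weight G \<C> wt H e3 = wt e1 / 2"
    "derived_weight G \<C> wt H e2 = 1 / 2"
    "derived_weight G \<C> wt H e4 = 1 / 2"
    using nw four_cycle_opposite[OF cyc c] cells
    by (simp_all add: derived_weight_def)
qed


section \<open>Rational functions\<close>

text \<open>The field of rational functions over \<open>'k\<close> in indeterminates indexed by the natural numbers:
  the fraction field of the ring of polynomials, a polynomial being a finitely supported map from
  monomials (finitely supported exponent vectors) to coefficients.\<close>

type_synonym 'k ratfun = "((nat \<Rightarrow>\<^sub>0 nat) \<Rightarrow>\<^sub>0 'k) fract"

definition indet :: "nat \<Rightarrow> 'k::field_char_0 ratfun" where
  "indet i = Fract (Poly_Mapping.single (Poly_Mapping.single i 1) 1) 1"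

definition indeterminate_weights ::
  "('v, 'e) ugraph \<Rightarrow> ('e \<Rightarrow> 'k::field_char_0 ratfun) \<Rightarrow> bool" where
  "indeterminate_weights H wt \<longleftrightarrow>
     (\<exists>\<iota>. inj_on \<iota> (edges H) \<and> (\<forall>e\<in>edges H. wt e = indet (\<iota> e)))"

end

theory Submission
  imports Defs
begin

text \<open>
  A perfect matching of \<open>H\<close> is recorded by its state: for every cell, the set of vertices of the
  cell that are matched inside this cell. Hence \<open>M(H)\<close> is the sum over all admissible states of
  products of local generating functions, one factor for each cell, and likewise for \<open>H'\<close>.
  Complementing the state inside every cell is a bijection from the states of \<open>H\<close> to those of
  \<open>H'\<close>: a vertex in two cells is matched in one of them before and after, while the extremal
  vertices of \<open>H\<close> are exchanged with those outside \<open>H\<close>. The derived weight is chosen so that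
  each local generating function changes under complementation by the factor \<open>\<Delta>(c)\<close> for a whole
  cell and by the factor \<open>2\<close> for a partial cell.
\<close>

section \<open>Matchings and their states\<close>

definition edge_degree :: "('v, 'e) ugraph \<Rightarrow> 'e set \<Rightarrow> 'v \<Rightarrow> nat" where
  "edge_degree G M v = card {e \<in> M. v \<in> ends G e}"

text \<open>Phrased by degrees because these add up over the cells. Letting \<open>v\<close> range
  over all vertices of \<open>G\<close> allows \<open>H\<close> and its complement to be treated
  inside the one graph \<open>G\<close>.\<close>

definition exact_cover :: "('v, 'e) ugraph \<Rightarrow> 'e set \<Rightarrow> 'v set \<Rightarrow> bool" where
  "exact_cover G M W \<longleftrightarrow> (\<forall>v\<in>verts G. edge_degree G M v = of_bool (v \<in> W))"

text \<open>One notion serves both levels: \<open>F = edges G\<close> yields the matching generating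
  functions, a single cell as \<open>F\<close> yields the local factors.\<close>

definition cover_gf ::
  "('v, 'e) ugraph \<Rightarrow> 'e set \<Rightarrow> 'v set \<Rightarrow> ('e \<Rightarrow> 'k::comm_semiring_1) \<Rightarrow> 'k" where
  "cover_gf G F W wt = (\<Sum>M | M \<subseteq> F \<and> exact_cover G M W. \<Prod>e\<in>M. wt e)"

text \<open>\<open>\<sigma> c\<close> records which vertices of \<open>c\<close> are matched inside
  \<open>c\<close>. Extensional functions are used so that a state is determined by its values on
  the cells.\<close>

definition states :: "('v, 'e) ugraph \<Rightarrow> 'e set set \<Rightarrow> 'v set \<Rightarrow> ('e set \<Rightarrow> 'v set) set" where
  "states G \<C> W =
     {\<sigma> \<in> (\<Pi>\<^sub>E c\<in>\<C>. Pow (covered G c)). \<forall>v\<in>verts G. card {c\<in>\<C>. v \<in> \<sigma> c} = of_bool (v \<in> W)}"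

lemma card_eq_1_iff_ex1: "card {e \<in> M. P e} = 1 \<longleftrightarrow> (\<exists>!e. e \<in> M \<and> P e)"
  by (auto simp: card_1_singleton_iff set_eq_iff) metis+

lemma exact_cover_iff:
  assumes "finite M"
  shows "exact_cover G M W \<longleftrightarrow>
    (\<forall>v\<in>verts G. if v \<in> W then \<exists>!e. e \<in> M \<and> v \<in> ends G e else \<forall>e\<in>M. v \<notin> ends G e)"
proof -
  have "edge_degree G M v = of_bool (v \<in> W) \<longleftrightarrow>
      (if v \<in> W then \<exists>!e. e \<in> M \<and> v \<in> ends G e else \<forall>e\<in>M. v \<notin> ends G e)" for v
    using assms card_eq_1_iff_ex1[of M "\<lambda>e. v \<in> ends G e"] by (auto simp: edge_degree_def)
  then show ?thesis
    by (simp add: exact_cover_def)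
qed

text \<open>\<open>exact_cover\<close> speaks only about vertices of \<open>G\<close>, so the last
  two hypotheses confine both sides to these. This is what makes the state of a matching
  unique.\<close>

lemma covered_eq_exact_cover:
  assumes "exact_cover G M S" "finite M" "covered G M \<subseteq> verts G" "S \<subseteq> verts G"
  shows "covered G M = S"
  using assms(3,4) assms(1)[unfolded exact_cover_iff[OF assms(2)]]
  by (fastforce simp: covered_def split: if_splits)

lemma exact_cover_covered:
  assumes "finite M" "\<And>e f. \<lbrakk>e \<in> M; f \<in> M; e \<noteq> f\<rbrakk> \<Longrightarrow> ends G e \<inter> ends G f = {}"
  shows "exact_cover G M (covered G M)"
  using assms(2) unfolding exact_cover_iff[OF assms(1)] by (auto simp: covered_def)

section \<open>Factorization over the cells\<close>

lemma edge_degree_cells: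
  assumes "partition_on E \<C>" "finite E" "M \<subseteq> E"
  shows "edge_degree G M v = (\<Sum>c\<in>\<C>. edge_degree G (M \<inter> c) v)"
proof -
  have "M = (\<Union>c\<in>\<C>. M \<inter> c)"
    using assms(1,3) by (auto simp: partition_on_def)
  then have "{e \<in> M. v \<in> ends G e} = (\<Union>c\<in>\<C>. {e \<in> M \<inter> c. v \<in> ends G e})"
    by blast
  moreover have "card (\<Union>c\<in>\<C>. {e \<in> M \<inter> c. v \<in> ends G e}) = (\<Sum>c\<in>\<C>. card {e \<in> M \<inter> c. v \<in> ends G e})"
  proof (rule card_UN_disjoint)
    show "finite \<C>"
      using assms by (metis finite_elements)
    show "\<forall>c\<in>\<C>. finite {e \<in> M \<inter> c. v \<in> ends G e}"
      using assms by (auto intro: finite_subset)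
    show "\<forall>c\<in>\<C>. \<forall>d\<in>\<C>. c \<noteq> d \<longrightarrow> {e \<in> M \<inter> c. v \<in> ends G e} \<inter> {e \<in> M \<inter> d. v \<in> ends G e} = {}"
      using assms(1) by (fastforce simp: partition_on_def disjoint_def)
  qed
  ultimately show ?thesis
    by (simp add: edge_degree_def)
qed

lemma sum_of_bool_card: "finite A \<Longrightarrow> (\<Sum>x\<in>A. of_bool (P x)) = card {x\<in>A. P x}"
  by (simp add: of_bool_def sum.If_cases Int_def)

text \<open>Multiplying out the right side gives a sum over pairs of a state and a family of local
  covers. Such pairs correspond to exact covers of \<open>W\<close>, because the degree of a vertex
  in the union is the number of cells whose state contains it.\<close>

lemma cover_gf_states:
  fixes wt :: "'e \<Rightarrow> 'k::comm_semiring_1"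
  assumes fin: "finite_graph G" and part: "partition_on (edges G) \<C>"
  shows "cover_gf G (edges G) W wt = (\<Sum>\<sigma>\<in>states G \<C> W. \<Prod>c\<in>\<C>. cover_gf G c (\<sigma> c) wt)"
proof -
  let ?E = "edges G"
  let ?loc = "\<lambda>\<sigma>. \<Pi>\<^sub>E c\<in>\<C>. {m. m \<subseteq> c \<and> exact_cover G m (\<sigma> c)}"
  have finE: "finite ?E" and ends: "\<And>e. e \<in> ?E \<Longrightarrow> ends G e \<subseteq> verts G"
    using fin by (auto simp: finite_graph_def)
  have fin\<C>: "finite \<C>"
    using finE part by (metis finite_elements)
  have sub: "c \<subseteq> ?E" and finc: "finite c" if "c \<in> \<C>" for c
    using that part finE by (auto simp: partition_on_def intro: finite_subset)
  have disj: "c \<inter> d = {}" if "c \<in> \<C>" "d \<in> \<C>" "c \<noteq> d" for c d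
    using that part by (auto simp: partition_on_def disjoint_def)
  have cov: "covered G F \<subseteq> verts G" if "F \<subseteq> ?E" for F
    using that ends by (auto simp: covered_def)
  have fincov: "finite (covered G c)" if "c \<in> \<C>" for c
    using fin cov[OF sub[OF that]] by (simp add: finite_graph_def finite_subset)
  have "finite (\<Pi>\<^sub>E c\<in>\<C>. Pow (covered G c))"
    using fin\<C> fincov by (intro finite_PiE) auto
  then have fins: "finite (states G \<C> W)"
    by (rule finite_subset[rotated]) (auto simp: states_def)
  have finloc: "finite (?loc \<sigma>)" for \<sigma>
    using fin\<C> finc by (intro finite_PiE) simp_all
  have Int_UN: "(\<Union>d\<in>\<C>. \<mu> d) \<inter> c = \<mu> c" if "\<mu> \<in> ?loc \<sigma>" "c \<in> \<C>" for \<mu> \<sigma> c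
  proof -
    have "\<mu> d \<subseteq> d" if "d \<in> \<C>" for d
      using \<open>\<mu> \<in> ?loc \<sigma>\<close> that by auto
    then show ?thesis
      using disj that(2) by blast
  qed
  have UN_sub: "(\<Union>d\<in>\<C>. \<mu> d) \<subseteq> ?E" if "\<mu> \<in> ?loc \<sigma>" for \<mu> \<sigma>
    using that sub by fastforce
  have "(\<Sum>\<sigma>\<in>states G \<C> W. \<Prod>c\<in>\<C>. cover_gf G c (\<sigma> c) wt) =
      (\<Sum>\<sigma>\<in>states G \<C> W. \<Sum>\<mu>\<in>?loc \<sigma>. \<Prod>c\<in>\<C>. \<Prod>e\<in>\<mu> c. wt e)"
    unfolding cover_gf_def by (intro sum.cong refl prod_sum_PiE) (use fin\<C> finc in auto)
  also have "\<dots> = (\<Sum>(\<sigma>, \<mu>)\<in>Sigma (states G \<C> W) ?loc. \<Prod>c\<in>\<C>. \<Prod>e\<in>\<mu> c. wt e)"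
    by (intro sum.Sigma) (use fins finloc in auto)
  also have "\<dots> = cover_gf G ?E W wt"
    unfolding cover_gf_def
  \<comment> \<open>A pair goes to the union of its local covers. Back from \<open>M\<close>, the
    local covers are the intersections with the cells, and the state consists of the vertices that
    they touch.\<close>
  proof (rule sum.reindex_bij_witness[where
        i = "\<lambda>M. (\<lambda>c\<in>\<C>. covered G (M \<inter> c), \<lambda>c\<in>\<C>. M \<inter> c)" and
        j = "\<lambda>(\<sigma>, \<mu>). \<Union>c\<in>\<C>. \<mu> c"], goal_cases)
    case (1 p)
    then obtain \<sigma> \<mu> where p: "p = (\<sigma>, \<mu>)" and \<sigma>: "\<sigma> \<in> states G \<C> W" and \<mu>: "\<mu> \<in> ?loc \<sigma>"
      by auto
    have "covered G (\<mu> c) = \<sigma> c" if "c \<in> \<C>" for c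
    proof (rule covered_eq_exact_cover)
      have "\<mu> c \<subseteq> c"
        using \<mu> that by auto
      then show "finite (\<mu> c)" "covered G (\<mu> c) \<subseteq> verts G"
        using finc sub cov that by (meson finite_subset order_trans)+
      show "exact_cover G (\<mu> c) (\<sigma> c)"
        using \<mu> that by auto
      show "\<sigma> c \<subseteq> verts G"
        using \<sigma> that cov[OF sub[OF that]] unfolding states_def by blast
    qed
    moreover have "\<sigma> \<in> extensional \<C>" "\<mu> \<in> extensional \<C>"
      using \<sigma> \<mu> by (auto simp: states_def PiE_def)
    ultimately show ?case
      using Int_UN[OF \<mu>] by (simp add: p fun_eq_iff restrict_def extensional_def)
  next
    case (2 p)
    then obtain \<sigma> \<mu> where p: "p = (\<sigma>, \<mu>)" and \<sigma>: "\<sigma> \<in> states G \<C> W" and \<mu>: "\<mu> \<in> ?loc \<sigma>"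
      by auto
    have "edge_degree G (\<Union>c\<in>\<C>. \<mu> c) v = of_bool (v \<in> W)" if "v \<in> verts G" for v
    proof -
      have "edge_degree G (\<Union>c\<in>\<C>. \<mu> c) v = (\<Sum>c\<in>\<C>. edge_degree G (\<mu> c) v)"
        using edge_degree_cells[OF part finE UN_sub[OF \<mu>]] Int_UN[OF \<mu>] by simp
      also have "\<dots> = (\<Sum>c\<in>\<C>. of_bool (v \<in> \<sigma> c))"
        using \<mu> that by (intro sum.cong) (auto simp: exact_cover_def PiE_iff)
      also have "\<dots> = of_bool (v \<in> W)"
        unfolding sum_of_bool_card[OF fin\<C>] using \<sigma> that by (simp add: states_def)
      finally show ?thesis .
    qed
    then show ?case
      using UN_sub[OF \<mu>] by (simp add: p exact_cover_def)
  next
    case (3 M)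
    then show ?case
      using part by (auto simp: partition_on_def)
  next
    case (4 M)
    then have M: "M \<subseteq> ?E" and ec: "exact_cover G M W"
      by auto
    \<comment> \<open>A local degree is bounded by the total degree, hence is 0 or 1. So
      \<open>M \<inter> c\<close> exactly covers whatever it touches.\<close>
    have loc: "edge_degree G (M \<inter> c) v = of_bool (v \<in> covered G (M \<inter> c))"
      if "c \<in> \<C>" "v \<in> verts G" for c v
    proof -
      have f: "finite {e \<in> M \<inter> c. v \<in> ends G e}"
        using M finE finite_subset by fastforce
      have "edge_degree G (M \<inter> c) v \<le> edge_degree G M v"
        unfolding edge_degree_def using M finE by (intro card_mono) (auto intro: finite_subset)
      also have "\<dots> \<le> 1"
        using ec that by (simp add: exact_cover_def)
      finally have "edge_degree G (M \<inter> c) v \<le> 1" .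
      moreover have "edge_degree G (M \<inter> c) v = 0 \<longleftrightarrow> v \<notin> covered G (M \<inter> c)"
        using f by (auto simp: edge_degree_def covered_def)
      ultimately show ?thesis
        by auto
    qed
    have "card {c\<in>\<C>. v \<in> (\<lambda>c\<in>\<C>. covered G (M \<inter> c)) c} = of_bool (v \<in> W)" if "v \<in> verts G" for v
    proof -
      have "card {c\<in>\<C>. v \<in> (\<lambda>c\<in>\<C>. covered G (M \<inter> c)) c} = (\<Sum>c\<in>\<C>. of_bool (v \<in> covered G (M \<inter> c)))"
        unfolding sum_of_bool_card[OF fin\<C>] by (simp cong: conj_cong)
      also have "\<dots> = edge_degree G M v"
        unfolding edge_degree_cells[OF part finE M] using loc that by (intro sum.cong) auto
      finally show ?thesis
        using ec that by (simp add: exact_cover_def)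
    qed
    moreover have "covered G (M \<inter> c) \<subseteq> covered G c" for c
      by (auto simp: covered_def)
    ultimately have "(\<lambda>c\<in>\<C>. covered G (M \<inter> c)) \<in> states G \<C> W"
      by (auto simp: states_def)
    moreover have "(\<lambda>c\<in>\<C>. M \<inter> c) \<in> ?loc (\<lambda>c\<in>\<C>. covered G (M \<inter> c))"
      using loc by (auto simp: exact_cover_def)
    ultimately show ?case
      by simp
  next
    case (5 p)
    then obtain \<sigma> \<mu> where p: "p = (\<sigma>, \<mu>)" and \<mu>: "\<mu> \<in> ?loc \<sigma>"
      by auto
    have \<mu>c: "\<mu> c \<subseteq> c" if "c \<in> \<C>" for c
      using \<mu> that by auto
    have "(\<Prod>e\<in>(\<Union>c\<in>\<C>. \<mu> c). wt e) = (\<Prod>c\<in>\<C>. \<Prod>e\<in>\<mu> c. wt e)"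
    proof (rule prod.UNION_disjoint)
      show "\<forall>c\<in>\<C>. finite (\<mu> c)"
        using \<mu>c finc by (meson finite_subset)
      show "\<forall>c\<in>\<C>. \<forall>d\<in>\<C>. c \<noteq> d \<longrightarrow> \<mu> c \<inter> \<mu> d = {}"
        using \<mu>c disj by blast
    qed (rule fin\<C>)
    then show ?case
      by (simp add: p)
  qed
  finally show ?thesis
    by simp
qed

text \<open>A vertex in \<open>n\<close> cells that is chosen \<open>k\<close> times is chosen
  \<open>n - k\<close> times after complementation. If \<open>n = 2\<close>, the vertex lies in
  \<open>W\<close> by \<open>ext\<close>, and \<open>k = 1\<close> is preserved; if
  \<open>n = 1\<close>, the values 0 and 1 are exchanged, which is the symmetric difference with the
  extremal vertices.\<close>

lemma bij_betw_states_complement: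
  assumes cell: "cellular_graph G \<C>" and W: "W \<subseteq> verts G"
    and ext: "verts G - W \<subseteq> extremal_verts G \<C>"
  shows "bij_betw (\<lambda>\<sigma>. \<lambda>c\<in>\<C>. covered G c - \<sigma> c)
    (states G \<C> W) (states G \<C> (sym_diff W (extremal_verts G \<C>)))"
proof -
  let ?W = "sym_diff W (extremal_verts G \<C>)"
  let ?f = "\<lambda>\<sigma>. \<lambda>c\<in>\<C>. covered G c - \<sigma> c"
  have fin\<C>: "finite \<C>"
    using cell unfolding cellular_graph_def finite_graph_def by (metis finite_elements)
  have compl: "card {c\<in>\<C>. v \<in> ?f \<sigma> c} = card (cells_at G \<C> v) - card {c\<in>\<C>. v \<in> \<sigma> c}"
    and le: "card {c\<in>\<C>. v \<in> \<sigma> c} \<le> card (cells_at G \<C> v)"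
    if "\<sigma> \<in> (\<Pi>\<^sub>E c\<in>\<C>. Pow (covered G c))" for \<sigma> v
  proof -
    have sub: "{c\<in>\<C>. v \<in> \<sigma> c} \<subseteq> cells_at G \<C> v"
      using that by (auto simp: cells_at_def)
    have "{c\<in>\<C>. v \<in> ?f \<sigma> c} = cells_at G \<C> v - {c\<in>\<C>. v \<in> \<sigma> c}"
      by (auto simp: cells_at_def)
    then show "card {c\<in>\<C>. v \<in> ?f \<sigma> c} = card (cells_at G \<C> v) - card {c\<in>\<C>. v \<in> \<sigma> c}"
      using sub fin\<C> by (simp add: card_Diff_subset)
    show "card {c\<in>\<C>. v \<in> \<sigma> c} \<le> card (cells_at G \<C> v)"
      using sub fin\<C> by (intro card_mono) (auto simp: cells_at_def)
  qed
  have bnd: "card (cells_at G \<C> v) = 1 \<or> card (cells_at G \<C> v) = 2" if "v \<in> verts G" for v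
    using cell that unfolding cellular_graph_def by force
  have ext_iff: "v \<in> extremal_verts G \<C> \<longleftrightarrow> card (cells_at G \<C> v) = 1" if "v \<in> verts G" for v
    using that by (simp add: extremal_verts_def)
  \<comment> \<open>The difference in \<open>compl\<close> is truncated subtraction of natural
    numbers; \<open>le\<close> makes it exact.\<close>
  have iff: "card {c\<in>\<C>. v \<in> ?f \<sigma> c} = of_bool (v \<in> ?W) \<longleftrightarrow>
      card {c\<in>\<C>. v \<in> \<sigma> c} = of_bool (v \<in> W)"
    if "\<sigma> \<in> (\<Pi>\<^sub>E c\<in>\<C>. Pow (covered G c))" "v \<in> verts G" for \<sigma> v
    using compl[OF that(1), of v] le[OF that(1), of v] bnd[OF that(2)] ext_iff[OF that(2)] that(2) ext
    by (auto simp: of_bool_def)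
  have f_in: "?f \<sigma> \<in> (\<Pi>\<^sub>E c\<in>\<C>. Pow (covered G c))" for \<sigma>
    by auto
  have invol: "?f (?f \<sigma>) = \<sigma>" if "\<sigma> \<in> (\<Pi>\<^sub>E c\<in>\<C>. Pow (covered G c))" for \<sigma>
    using that by (fastforce simp: PiE_iff extensional_def fun_eq_iff)
  have state_iff: "?f \<sigma> \<in> states G \<C> ?W \<longleftrightarrow> \<sigma> \<in> states G \<C> W"
    if "\<sigma> \<in> (\<Pi>\<^sub>E c\<in>\<C>. Pow (covered G c))" for \<sigma>
    using iff[OF that] f_in[of \<sigma>] that by (simp add: states_def)
  have states_sub: "states G \<C> U \<subseteq> (\<Pi>\<^sub>E c\<in>\<C>. Pow (covered G c))" for U
    by (auto simp: states_def)
  show ?thesis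
  proof (rule bij_betw_byWitness[where f' = ?f])
    show "\<forall>\<sigma>\<in>states G \<C> W. ?f (?f \<sigma>) = \<sigma>" "\<forall>\<sigma>\<in>states G \<C> ?W. ?f (?f \<sigma>) = \<sigma>"
      using invol states_sub by blast+
    show "?f ` states G \<C> W \<subseteq> states G \<C> ?W"
      using state_iff states_sub by blast
    \<comment> \<open>Applying \<open>state_iff\<close> to \<open>?f \<tau>\<close> and using the
      involution avoids repeating the count for \<open>?W\<close>.\<close>
    show "?f ` states G \<C> ?W \<subseteq> states G \<C> W"
    proof
      fix \<sigma> assume "\<sigma> \<in> ?f ` states G \<C> ?W"
      then obtain \<tau> where \<tau>: "\<tau> \<in> states G \<C> ?W" "\<sigma> = ?f \<tau>"
        by blast
      then show "\<sigma> \<in> states G \<C> W"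
        using state_iff[OF f_in[of \<tau>]] invol[of \<tau>] states_sub by (metis (no_types, lifting) subsetD)
    qed
  qed
qed

section \<open>The local identity\<close>

lemma four_cycle_rotate:
  "four_cycle G A B C D e1 e2 e3 e4 \<Longrightarrow> four_cycle G B C D A e2 e3 e4 e1"
  by (auto simp: four_cycle_def)

text \<open>A 4-cycle has seven matchings: the empty one, four single edges and two pairs of
  opposite edges. Only the two pairs cover the same set, so at most one of the six indicators is
  nonzero, and it selects the terms for \<open>S\<close>.\<close>

lemma cover_gf_four_cycle:
  fixes wt :: "'e \<Rightarrow> 'k::comm_semiring_1"
  assumes cyc: "four_cycle G A B C D e1 e2 e3 e4"
    and fin: "finite_graph G" and S: "S \<subseteq> {A, B, C, D}"
  shows "cover_gf G {e1, e2, e3, e4} S wt =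
    of_bool (S = {}) + of_bool (S = {A, B}) * wt e1 + of_bool (S = {B, C}) * wt e2 +
    of_bool (S = {C, D}) * wt e3 + of_bool (S = {D, A}) * wt e4 +
    of_bool (S = {A, B, C, D}) * (wt e1 * wt e3 + wt e2 * wt e4)"
proof -
  have ends: "ends G e1 = {A, B}" "ends G e2 = {B, C}" "ends G e3 = {C, D}" "ends G e4 = {D, A}"
    and ne: "A \<noteq> B" "A \<noteq> C" "A \<noteq> D" "B \<noteq> C" "B \<noteq> D" "C \<noteq> D"
    using cyc by (simp_all add: four_cycle_def)
  have "ends G e1 \<subseteq> verts G" "ends G e3 \<subseteq> verts G"
    using cyc fin unfolding four_cycle_def finite_graph_def by blast+
  then have vs: "A \<in> verts G" "B \<in> verts G" "C \<in> verts G" "D \<in> verts G"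
    by (simp_all add: ends)
  have nee: "e1 \<noteq> e2" "e1 \<noteq> e3" "e1 \<noteq> e4" "e2 \<noteq> e3" "e2 \<noteq> e4" "e3 \<noteq> e4"
    using four_cycle_distinct_edges[OF cyc] by simp_all
  let ?ms = "{{}, {e1}, {e2}, {e3}, {e4}, {e1, e3}, {e2, e4}}"
  have covered: "covered G {} = {}" "covered G {e1} = {A, B}" "covered G {e2} = {B, C}"
    "covered G {e3} = {C, D}" "covered G {e4} = {D, A}"
    "covered G {e1, e3} = {A, B, C, D}" "covered G {e2, e4} = {A, B, C, D}"
    by (auto simp: covered_def ends)
  \<comment> \<open>Consecutive edges share a vertex and exclude each other, so \<open>m\<close>
    lies inside one of the two pairs of opposite edges.\<close>
  have ms: "m \<in> ?ms" if m: "m \<subseteq> {e1, e2, e3, e4}" and ec: "exact_cover G m S" for m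
  proof -
    have "finite m"
      using m by (rule finite_subset) simp
    then have "e = f" if "v \<in> verts G" "v \<in> ends G e" "v \<in> ends G f" "e \<in> m" "f \<in> m" for v e f
      using ec that by (auto simp: exact_cover_iff split: if_splits)
    note share = this[OF vs(2), of e1 e2] this[OF vs(3), of e2 e3] this[OF vs(4), of e3 e4]
      this[OF vs(1), of e4 e1]
    have "e1 \<notin> m \<or> e2 \<notin> m" "e2 \<notin> m \<or> e3 \<notin> m" "e3 \<notin> m \<or> e4 \<notin> m" "e4 \<notin> m \<or> e1 \<notin> m"
      using share nee unfolding ends by blast+
    then have "m \<subseteq> {e1, e3} \<or> m \<subseteq> {e2, e4}"
      using m by blast
    then have "m \<in> Pow {e1, e3} \<or> m \<in> Pow {e2, e4}"
      by simp
    then show ?thesis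
      unfolding Pow_insert Pow_empty by auto
  qed
  have ec: "exact_cover G m S \<longleftrightarrow> S = covered G m" if "m \<in> ?ms" for m
  proof
    have fm: "finite m" and cm: "covered G m \<subseteq> {A, B, C, D}"
      using that covered by auto
    show "S = covered G m" if "exact_cover G m S"
      using covered_eq_exact_cover[OF that fm] cm S vs by blast
    have "ends G e \<inter> ends G f = {}" if "e \<in> m" "f \<in> m" "e \<noteq> f" for e f
      using \<open>m \<in> ?ms\<close> that ne by (elim insertE emptyE) (simp; elim disjE; simp add: ends)+
    from exact_cover_covered[OF fm this] show "exact_cover G m S" if "S = covered G m"
      using that by simp
  qed
  have "cover_gf G {e1, e2, e3, e4} S wt = (\<Sum>m\<in>{m \<in> ?ms. S = covered G m}. \<Prod>e\<in>m. wt e)"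
  proof -
    have "m \<subseteq> {e1, e2, e3, e4}" if "m \<in> ?ms" for m
      using that by (elim insertE emptyE) simp_all
    then have "m \<subseteq> {e1, e2, e3, e4} \<and> exact_cover G m S \<longleftrightarrow> m \<in> ?ms \<and> S = covered G m" for m
      using ms[of m] ec[of m] by metis
    then show ?thesis
      by (simp only: cover_gf_def)
  qed
  also have "\<dots> = (\<Sum>m\<in>?ms. of_bool (S = covered G m) * (\<Prod>e\<in>m. wt e))"
    by (subst sum.inter_filter, simp, rule sum.cong[OF refl]) (simp only: of_bool_def if_distribR split: if_split, simp)
  also have "\<dots> = of_bool (S = {}) + of_bool (S = {A, B}) * wt e1 + of_bool (S = {B, C}) * wt e2 +
    of_bool (S = {C, D}) * wt e3 + of_bool (S = {D, A}) * wt e4 +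
    of_bool (S = {A, B, C, D}) * (wt e1 * wt e3 + wt e2 * wt e4)"
  proof -
    have "distinct [{}, {e1}, {e2}, {e3}, {e4}, {e1, e3}, {e2, e4}]"
      using nee by (auto simp: doubleton_eq_iff)
    from sum.distinct_set_conv_list[OF this]
    have expand: "(\<Sum>m\<in>?ms. f m) = f {} + (f {e1} + (f {e2} + (f {e3} + (f {e4} + (f {e1, e3} + f {e2, e4})))))"
      for f :: "_ \<Rightarrow> 'k"
      by (simp only: list.set list.map sum_list_simps add_0_right)
    have pair: "(\<Prod>e\<in>{e1, e3}. wt e) = wt e1 * wt e3" "(\<Prod>e\<in>{e2, e4}. wt e) = wt e2 * wt e4"
      using nee by simp_all
    have single: "(\<Prod>e\<in>{x}. wt e) = wt x" for x
      by simp
    show ?thesis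
      by (simp only: expand covered pair single prod.empty mult_1_right distrib_left add.assoc)
  qed
  finally show ?thesis .
qed

text \<open>Complementation exchanges the ends of an edge with those of the opposite edge, and the
  empty set with the full one. Writing the result with indicators of \<open>S\<close> lets it be
  compared term by term with the previous formula.\<close>

lemma cover_gf_four_cycle_complement:
  fixes wt :: "'e \<Rightarrow> 'k::comm_semiring_1"
  assumes cyc: "four_cycle G A B C D e1 e2 e3 e4"
    and fin: "finite_graph G" and S: "S \<subseteq> {A, B, C, D}"
  shows "cover_gf G {e1, e2, e3, e4} ({A, B, C, D} - S) wt =
    of_bool (S = {A, B, C, D}) + of_bool (S = {C, D}) * wt e1 + of_bool (S = {D, A}) * wt e2 +
    of_bool (S = {A, B}) * wt e3 + of_bool (S = {B, C}) * wt e4 +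
    of_bool (S = {}) * (wt e1 * wt e3 + wt e2 * wt e4)"
proof -
  let ?V = "{A, B, C, D}"
  have ne: "A \<noteq> B" "A \<noteq> C" "A \<noteq> D" "B \<noteq> C" "B \<noteq> D" "C \<noteq> D"
    using cyc by (simp_all add: four_cycle_def)
  have *: "?V - S = T \<longleftrightarrow> S = ?V - T" if "T \<subseteq> ?V" for T
    using S that by blast
  have "?V - {A, B} = {C, D}" "?V - {B, C} = {D, A}" "?V - {C, D} = {A, B}" "?V - {D, A} = {B, C}"
    using ne by auto
  moreover have "?V - {} = ?V" "?V - ?V = {}"
    by simp_all
  moreover note *[of "{}"] *[of "{A, B}"] *[of "{B, C}"] *[of "{C, D}"] *[of "{D, A}"] *[of ?V]
  ultimately have iffs: "?V - S = {} \<longleftrightarrow> S = ?V" "?V - S = {A, B} \<longleftrightarrow> S = {C, D}" "?V - S = {B, C} \<longleftrightarrow> S = {D, A}"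
    "?V - S = {C, D} \<longleftrightarrow> S = {A, B}" "?V - S = {D, A} \<longleftrightarrow> S = {B, C}" "?V - S = ?V \<longleftrightarrow> S = {}"
    by simp_all
  have "?V - S \<subseteq> ?V"
    by blast
  from cover_gf_four_cycle[OF cyc fin this] show ?thesis
    by (simp only: iffs)
qed

text \<open>Two opposite edges in \<open>H\<close> would cover the cell, so at most one edge of each
  opposite pair is present. This leaves one edge or two adjacent ones, and a rotation moves them to
  the front.\<close>

lemma partial_cell_cases:
  assumes cyc: "four_cycle G A B C D e1 e2 e3 e4" and c: "c = {e1, e2, e3, e4}"
    and ne: "c \<inter> edges H \<noteq> {}" and np: "\<not> whole_cell G H c"
  obtains A B C D e1 e2 e3 e4 where
    "four_cycle G A B C D e1 e2 e3 e4" "c = {e1, e2, e3, e4}"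
    "c \<inter> edges H = {e1} \<or> c \<inter> edges H = {e1, e2}"
proof -
  note r1 = four_cycle_rotate[OF cyc]
  note r2 = four_cycle_rotate[OF r1]
  note r3 = four_cycle_rotate[OF r2]
  have ends: "ends G e1 = {A, B}" "ends G e2 = {B, C}" "ends G e3 = {C, D}" "ends G e4 = {D, A}"
    using cyc by (simp_all add: four_cycle_def)
  have Vc: "covered G c = {A, B, C, D}"
    by (auto simp: c covered_def ends)
  have not_both: "\<not> (e \<in> edges H \<and> f \<in> edges H)"
    if "e \<in> c" "f \<in> c" "ends G e \<union> ends G f = {A, B, C, D}" for e f
  proof
    assume "e \<in> edges H \<and> f \<in> edges H"
    then have "covered G c \<subseteq> covered G (c \<inter> edges H)"
      unfolding Vc that(3)[symmetric] using that(1,2) by (auto simp: covered_def)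
    moreover have "covered G (c \<inter> edges H) \<subseteq> covered G c"
      by (auto simp: covered_def)
    ultimately show False
      using np by (simp add: whole_cell_def)
  qed
  have not_whole: "\<not> (e1 \<in> edges H \<and> e3 \<in> edges H)" "\<not> (e2 \<in> edges H \<and> e4 \<in> edges H)"
    by (rule not_both; force simp: c ends)+
  have cs: "c = {e2, e3, e4, e1}" "c = {e3, e4, e1, e2}" "c = {e4, e1, e2, e3}"
    using c by auto
  consider "c \<inter> edges H = {e1} \<or> c \<inter> edges H = {e1, e2}" | "c \<inter> edges H = {e2} \<or> c \<inter> edges H = {e2, e3}"
    | "c \<inter> edges H = {e3} \<or> c \<inter> edges H = {e3, e4}" | "c \<inter> edges H = {e4} \<or> c \<inter> edges H = {e4, e1}"
    using ne not_whole four_cycle_distinct_edges[OF cyc] unfolding c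
    by (cases "e1 \<in> edges H"; cases "e2 \<in> edges H"; cases "e3 \<in> edges H"; cases "e4 \<in> edges H") auto
  then show thesis
  proof cases
    case 1 then show ?thesis by (rule that[OF cyc c])
  next
    case 2 then show ?thesis by (rule that[OF r1 cs(1)])
  next
    case 3 then show ?thesis by (rule that[OF r2 cs(2)])
  next
    case 4 then show ?thesis by (rule that[OF r3 cs(3)])
  qed
qed

text \<open>Term by term in \<open>S\<close>: the empty set gives
  \<open>1 = 2 * (1/4 + 1/4)\<close>, since opposite derived weights multiply to 1/4, and the ends
  of an edge of weight \<open>x\<close> in \<open>H\<close> give \<open>x = 2 * (x / 2)\<close>,
  from the opposite edge. The weight \<open>wt0\<close> is separate because \<open>wt\<close> may be
  nonzero on edges of the cell outside \<open>H\<close>.\<close>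

lemma partial_cell_complement:
  fixes wt wt0 :: "'e \<Rightarrow> 'k::field"
  assumes cell: "cellular_graph G \<C>" "c \<in> \<C>" and two: "(2::'k) \<noteq> 0"
    and ne: "c \<inter> edges H \<noteq> {}" and np: "\<not> whole_cell G H c"
    and nz: "\<And>e. e \<in> c \<inter> edges H \<Longrightarrow> wt e \<noteq> 0"
    and wt0: "\<And>e. e \<in> c \<Longrightarrow> wt0 e = (if e \<in> edges H then wt e else 0)"
    and S: "S \<subseteq> covered G (c \<inter> edges H)"
  shows "cover_gf G c S wt0 = 2 * cover_gf G c (covered G c - S) (derived_weight G \<C> wt H)"
proof -
  have fin: "finite_graph G"
    using cell by (simp add: cellular_graph_def)
  obtain A B C D e1 e2 e3 e4 where
    cyc: "four_cycle G A B C D e1 e2 e3 e4" and c: "c = {e1, e2, e3, e4}" and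
    cH: "c \<inter> edges H = {e1} \<or> c \<inter> edges H = {e1, e2}"
    using cell partial_cell_cases[OF _ _ ne np] unfolding cellular_graph_def by metis
  have ends: "ends G e1 = {A, B}" "ends G e2 = {B, C}" "ends G e3 = {C, D}" "ends G e4 = {D, A}"
    and neq: "A \<noteq> D" "B \<noteq> D" "C \<noteq> D"
    using cyc by (simp_all add: four_cycle_def)
  note nee = four_cycle_distinct_edges[OF cyc]
  \<comment> \<open>Products of two derived weights have denominator 4, which the closing
    simplification must cancel.\<close>
  have four: "(4::'k) \<noteq> 0"
    using two mult_eq_0_iff[of "2::'k" 2] by simp
  have Vc: "covered G c = {A, B, C, D}"
    by (auto simp: c covered_def ends)
  \<comment> \<open>\<open>D\<close> is touched by neither \<open>e1\<close> nor \<open>e2\<close>,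
    so every indicator of a set containing \<open>D\<close> vanishes.\<close>
  have SD: "S \<subseteq> {A, B, C, D}" "D \<notin> S"
    using S cH neq by (auto simp: covered_def ends)
  then have nS: "S \<noteq> {C, D}" "S \<noteq> {D, A}" "S \<noteq> {A, B, C, D}"
    by auto
  note expand = cover_gf_four_cycle[OF cyc fin SD(1)]
    cover_gf_four_cycle_complement[OF cyc fin SD(1)]
  from cH show ?thesis
  proof
    assume H: "c \<inter> edges H = {e1}"
    have "S \<noteq> {B, C}"
      using S cyc unfolding H by (auto simp: covered_def four_cycle_def)
    moreover have "e1 \<in> c \<inter> edges H" "e2 \<in> c - edges H"
      using H nee by (auto simp: c)
    then have "wt0 e1 = wt e1" "wt0 e2 = 0" "wt e1 \<noteq> 0"
      using wt0 nz by simp_all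
    ultimately show ?thesis
      using two four unfolding Vc unfolding c expand derived_weight_one[OF cell cyc c H]
      by (simp add: nS field_simps)
  next
    assume H: "c \<inter> edges H = {e1, e2}"
    then have "e1 \<in> c \<inter> edges H" "e2 \<in> c \<inter> edges H"
      by simp_all
    then have "wt0 e1 = wt e1" "wt0 e2 = wt e2" "wt e1 \<noteq> 0" "wt e2 \<noteq> 0"
      using wt0 nz by simp_all
    then show ?thesis
      using two four unfolding Vc unfolding c expand derived_weight_two[OF cell cyc c H]
      by (simp add: nS field_simps)
  qed
qed

text \<open>Since each derived weight is the opposite weight over \<Delta>, the edge terms agree
  after multiplication by \<Delta>. The full set gives \<Delta> on both sides, and the empty set
  gives 1 because the derived weights have cell-factor 1/\<Delta>.\<close>

lemma whole_cell_complement: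
  fixes wt wt0 :: "'e \<Rightarrow> 'k::field"
  assumes cell: "cellular_graph G \<C>" "c \<in> \<C>"
    and whole: "whole_cell G H c" and nz: "cell_factor G wt c \<noteq> 0"
    and wt0: "\<And>e. e \<in> c \<Longrightarrow> wt0 e = wt e" and S: "S \<subseteq> covered G c"
  shows "cover_gf G c S wt0 =
    cell_factor G wt c * cover_gf G c (covered G c - S) (derived_weight G \<C> wt H)"
proof -
  have fin: "finite_graph G"
    using cell by (simp add: cellular_graph_def)
  obtain A B C D e1 e2 e3 e4 where
    cyc: "four_cycle G A B C D e1 e2 e3 e4" and c: "c = {e1, e2, e3, e4}"
    using cell unfolding cellular_graph_def by metis
  have Vc: "covered G c = {A, B, C, D}"
    using cyc by (auto simp: c covered_def four_cycle_def)
  define d where "d = cell_factor G wt c"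
  have d: "wt e1 * wt e3 + wt e2 * wt e4 = d"
    using cell_factor_eq[OF cyc c, of wt] by (simp add: d_def)
  have dw: "derived_weight G \<C> wt H e1 = wt e3 / d" "derived_weight G \<C> wt H e2 = wt e4 / d"
    "derived_weight G \<C> wt H e3 = wt e1 / d" "derived_weight G \<C> wt H e4 = wt e2 / d"
    using derived_weight_whole[OF cell whole, of _ wt] four_cycle_opposite[OF cyc c]
    by (auto simp: c d_def)
  have w: "wt0 e1 = wt e1" "wt0 e2 = wt e2" "wt0 e3 = wt e3" "wt0 e4 = wt e4"
    using wt0 by (simp_all add: c)
  have dnz: "d \<noteq> 0"
    using nz by (simp add: d_def)
  have "wt e3 / d * (wt e1 / d) + wt e4 / d * (wt e2 / d) = (wt e1 * wt e3 + wt e2 * wt e4) / (d * d)"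
    by (simp add: add_divide_distrib mult.commute)
  then have inv: "wt e3 / d * (wt e1 / d) + wt e4 / d * (wt e2 / d) = 1 / d"
    using d dnz by simp
  have S': "S \<subseteq> {A, B, C, D}"
    using S Vc by simp
  show ?thesis
    unfolding Vc d_def[symmetric]
    unfolding c cover_gf_four_cycle[OF cyc fin S'] cover_gf_four_cycle_complement[OF cyc fin S'] w dw inv d
    using dnz by (simp add: distrib_left)
qed

section \<open>Nonvanishing in the field of rational functions\<close>

section \<open>Indeterminates\<close>

text \<open>The coefficient at \<open>m\<close> is 1, or 2 if the monomials coincide; it is nonzero
  in characteristic 0, so no cancellation occurs.\<close>

lemma Fract_single_add_neq_0:
  fixes m m' :: "nat \<Rightarrow>\<^sub>0 nat"
  shows "Fract (Poly_Mapping.single m 1) 1 + Fract (Poly_Mapping.single m' 1) 1 \<noteq>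
    (0 :: 'k::field_char_0 ratfun)"
proof -
  have "Poly_Mapping.lookup (Poly_Mapping.single m 1 + Poly_Mapping.single m' (1::'k)) m \<noteq> 0"
    by (simp add: lookup_add lookup_single when_def)
  then have "Poly_Mapping.single m 1 + Poly_Mapping.single m' (1::'k) \<noteq> 0"
    by auto
  then show ?thesis
    by (simp add: Zero_fract_def eq_fract)
qed

text \<open>The constant 1 is the monomial with exponent vector 0, so 2 is a sum of two
  monomials.\<close>

lemma two_ratfun_neq_0: "(2 :: 'k::field_char_0 ratfun) \<noteq> 0"
  using Fract_single_add_neq_0[of 0 0, where 'k = 'k]
  by (simp flip: One_fract_def)

lemma indet_mult:
  "indet i * indet j = Fract (Poly_Mapping.single (Poly_Mapping.single i 1 + Poly_Mapping.single j 1) 1) 1"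
  by (simp add: indet_def mult_single)

lemma indet_mult_add_neq_0: "indet i * indet j + indet k * indet l \<noteq> 0"
  unfolding indet_mult by (rule Fract_single_add_neq_0)

lemma indet_neq_0: "indet i \<noteq> 0"
  using indet_mult_add_neq_0[of i i i i] by auto

text \<open>Covering all four vertices forces a pair of opposite edges into \<open>H\<close>. Its
  product of indeterminates cannot be cancelled by the other summand, which is zero or again such a
  product.\<close>

lemma cell_factor_neq_0:
  assumes cell: "cellular_graph G \<C>" "c \<in> \<C>" and whole: "whole_cell G H c"
    and indet: "\<And>e. e \<in> c \<inter> edges H \<Longrightarrow> \<exists>i. wt e = indet i"
    and zero: "\<And>e. e \<in> c - edges H \<Longrightarrow> wt e = 0"
  shows "cell_factor G wt c \<noteq> 0"
proof -
  obtain A B C D e1 e2 e3 e4 where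
    cyc: "four_cycle G A B C D e1 e2 e3 e4" and c: "c = {e1, e2, e3, e4}"
    using cell unfolding cellular_graph_def by metis
  have ends: "ends G e1 = {A, B}" "ends G e2 = {B, C}" "ends G e3 = {C, D}" "ends G e4 = {D, A}"
    and ne: "distinct [A, B, C, D]"
    using cyc by (simp_all add: four_cycle_def)
  have "{A, B, C, D} \<subseteq> covered G (c \<inter> edges H)"
    using whole unfolding whole_cell_def by (auto simp: c covered_def ends)
  then have "e1 \<in> edges H \<and> e3 \<in> edges H \<or> e2 \<in> edges H \<and> e4 \<in> edges H"
    using ne by (auto simp: c covered_def ends)
  moreover have "wt e1 = 0 \<and> e1 \<notin> edges H \<or> (\<exists>i. wt e1 = indet i)"
    "wt e2 = 0 \<and> e2 \<notin> edges H \<or> (\<exists>i. wt e2 = indet i)"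
    "wt e3 = 0 \<and> e3 \<notin> edges H \<or> (\<exists>i. wt e3 = indet i)"
    "wt e4 = 0 \<and> e4 \<notin> edges H \<or> (\<exists>i. wt e4 = indet i)"
    using indet zero by (auto simp: c)
  ultimately show ?thesis
    unfolding cell_factor_eq[OF cyc c]
    by (auto simp: indet_neq_0 indet_mult_add_neq_0)
qed

section \<open>The complementation theorem\<close>

lemma subgraph_ends:
  assumes "subgraph H G" "e \<in> edges H"
  shows "ends H e = ends G e" "ends G e \<subseteq> verts H"
proof -
  show eq: "ends H e = ends G e"
    using assms by (simp add: subgraph_def)
  show "ends G e \<subseteq> verts H"
    using assms eq unfolding subgraph_def finite_graph_def by metis
qed

lemma perfect_matching_iff:
  assumes "finite_graph G" "subgraph H G"
  shows "perfect_matching H M \<longleftrightarrow> M \<subseteq> edges H \<and> exact_cover G M (verts H)"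
proof (cases "M \<subseteq> edges H")
  case True
  have ends: "ends H e = ends G e" "ends G e \<subseteq> verts H" if "e \<in> M" for e
    using subgraph_ends[OF assms(2)] True that by blast+
  have "finite M"
    using assms True by (auto simp: subgraph_def finite_graph_def intro: finite_subset)
  have "(\<exists>!e. e \<in> M \<and> v \<in> ends H e) \<longleftrightarrow> (\<exists>!e. e \<in> M \<and> v \<in> ends G e)" for v
    using ends by metis
  moreover have "verts H \<subseteq> verts G"
    using assms by (simp add: subgraph_def)
  ultimately show ?thesis
    using True ends(2) unfolding perfect_matching_def exact_cover_iff[OF \<open>finite M\<close>] by (auto; blast)
qed (simp add: perfect_matching_def)

text \<open>Extending the weight by 0 lets the sum run over edge sets of \<open>G\<close>: any set
  with an edge outside \<open>H\<close> contributes 0.\<close>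

lemma matching_gf_subgraph:
  assumes "subgraph H G"
  shows "matching_gf H wt =
    cover_gf G (edges G) (verts H) (\<lambda>e. if e \<in> edges H then wt e else 0)"
proof -
  have fin: "finite_graph G" and finE: "finite (edges G)" and sub: "edges H \<subseteq> edges G"
    using assms by (auto simp: subgraph_def finite_graph_def)
  have "matching_gf H wt = (\<Sum>M | M \<subseteq> edges H \<and> exact_cover G M (verts H). \<Prod>e\<in>M. wt e)"
    by (simp add: matching_gf_def perfect_matching_iff[OF fin assms])
  also have "\<dots> = cover_gf G (edges G) (verts H) (\<lambda>e. if e \<in> edges H then wt e else 0)"
    unfolding cover_gf_def
  proof (rule sum.mono_neutral_cong_left)
    show "\<forall>M\<in>{M. M \<subseteq> edges G \<and> exact_cover G M (verts H)} -
        {M. M \<subseteq> edges H \<and> exact_cover G M (verts H)}.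
        (\<Prod>e\<in>M. if e \<in> edges H then wt e else 0) = 0"
    proof
      fix M
      assume "M \<in> {M. M \<subseteq> edges G \<and> exact_cover G M (verts H)} -
        {M. M \<subseteq> edges H \<and> exact_cover G M (verts H)}"
      then have "finite M" "\<exists>e\<in>M. e \<notin> edges H"
        using finE by (auto intro: finite_subset)
      then show "(\<Prod>e\<in>M. if e \<in> edges H then wt e else 0) = 0"
        by (intro prod_zero) auto
    qed
  qed (use finE sub in \<open>auto intro!: prod.cong\<close>)
  finally show ?thesis .
qed

text \<open>An exact cover of \<open>W\<close> uses only edges with both ends in \<open>W\<close>,
  and an induced subgraph has all of these, so the weight stays as it is.\<close>

lemma matching_gf_induced_subgraph:
  assumes fin: "finite_graph G" and W: "W \<subseteq> verts G"
  shows "matching_gf (induced_subgraph G W) wt = cover_gf G (edges G) W wt"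
proof -
  have "subgraph (induced_subgraph G W) G"
    using fin W by (auto simp: subgraph_def induced_subgraph_def finite_graph_def intro: finite_subset)
  note pm = perfect_matching_iff[OF fin this]
  have "M \<subseteq> edges (induced_subgraph G W)" if M: "M \<subseteq> edges G" and ec: "exact_cover G M W" for M
  proof -
    have "finite M" "covered G M \<subseteq> verts G"
      using M fin by (auto simp: finite_graph_def covered_def intro: finite_subset)
    then have "covered G M = W"
      using covered_eq_exact_cover[OF ec] W by simp
    then show ?thesis
      using M by (auto simp: induced_subgraph_def covered_def)
  qed
  then have "perfect_matching (induced_subgraph G W) M \<longleftrightarrow> M \<subseteq> edges G \<and> exact_cover G M W" for M
    unfolding pm by (auto simp: induced_subgraph_def)
  then show ?thesis
    by (simp add: matching_gf_def cover_gf_def)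
qed

theorem theorem2p3:
  fixes G H :: "('v, 'e) ugraph"
    and \<C> :: "'e set set"
    and wt\<^sub>G wt\<^sub>H :: "'e \<Rightarrow> 'k::field_char_0 ratfun"
  assumes "cellular_completion G \<C> wt\<^sub>G H wt\<^sub>H"
    and "indeterminate_weights H wt\<^sub>H"
    and "cells_meet G \<C> H"
  shows "matching_gf H wt\<^sub>H =
    2 ^ card (partial_cells G \<C> H) *
    (\<Prod>c\<in>whole_cells G \<C> H. cell_factor G wt\<^sub>G c) *
    matching_gf (complement_graph G \<C> H) (derived_weight G \<C> wt\<^sub>G H)"
proof -
  have cell: "cellular_graph G \<C>" and sub: "subgraph H G"
    and wtH: "\<And>e. e \<in> edges H \<Longrightarrow> wt\<^sub>G e = wt\<^sub>H e"
    and wtG: "\<And>e. \<lbrakk>e \<in> edges G - edges H; ends G e \<subseteq> verts H\<rbrakk> \<Longrightarrow> wt\<^sub>G e = 0"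
    and ext: "verts G - verts H \<subseteq> extremal_verts G \<C>"
    using assms(1) by (auto simp: cellular_completion_def)
  have fin: "finite_graph G" and part: "partition_on (edges G) \<C>"
    using cell by (auto simp: cellular_graph_def)
  have fin\<C>: "finite \<C>"
    using fin part unfolding finite_graph_def by (metis finite_elements)
  have HG: "verts H \<subseteq> verts G"
    using sub by (simp add: subgraph_def)
  have indet: "\<exists>i. wt\<^sub>G e = indet i" if "e \<in> edges H" for e
    using assms(2) wtH that by (auto simp: indeterminate_weights_def)
  let ?wt0 = "\<lambda>e. if e \<in> edges H then wt\<^sub>H e else 0"
  let ?wt' = "derived_weight G \<C> wt\<^sub>G H"
  let ?W = "sym_diff (verts H) (extremal_verts G \<C>)"
  let ?k = "\<lambda>c. if whole_cell G H c then cell_factor G wt\<^sub>G c else 2"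
  have cH: "c \<subseteq> edges G" "c \<inter> edges H \<noteq> {}" "covered G c \<inter> verts H \<subseteq> covered G (c \<inter> edges H)"
    if "c \<in> \<C>" for c
    using part assms(3) that by (auto simp: cells_meet_def partition_on_def)
  have covH: "covered G (c \<inter> edges H) \<subseteq> verts H" for c
    using subgraph_ends(2)[OF sub] by (auto simp: covered_def)
  \<comment> \<open>All vertices of a whole cell lie in \<open>H\<close>, so the completion gives
    weight 0 to its edges outside \<open>H\<close>.\<close>
  have zero: "wt\<^sub>G e = 0" if "c \<in> \<C>" "whole_cell G H c" "e \<in> c - edges H" for c e
  proof (rule wtG)
    show "e \<in> edges G - edges H"
      using cH that by blast
    have "ends G e \<subseteq> covered G c"
      using that by (auto simp: covered_def)
    then show "ends G e \<subseteq> verts H"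
      using covH[of c] that(2) by (auto simp: whole_cell_def)
  qed
  have local: "cover_gf G c S ?wt0 = ?k c * cover_gf G c (covered G c - S) ?wt'"
    if c: "c \<in> \<C>" and S: "S \<subseteq> covered G c" "S \<subseteq> verts H" for c S
  proof (cases "whole_cell G H c")
    case True
    have "cell_factor G wt\<^sub>G c \<noteq> 0"
      using cell_factor_neq_0[OF cell c True] indet zero[OF c True] by blast
    moreover have "?wt0 e = wt\<^sub>G e" if "e \<in> c" for e
      using zero[OF c True] wtH that by simp
    ultimately show ?thesis
      using whole_cell_complement[OF cell c True _ _ S(1), of wt\<^sub>G ?wt0] True by simp
  next
    case False
    \<comment> \<open>Here \<open>cells_meet\<close> enters: vertices of \<open>c\<close> in
      \<open>H\<close> are ends of edges of \<open>H\<close> in \<open>c\<close>, which bounds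
      \<open>S\<close> as the partial case requires.\<close>
    have "cover_gf G c S ?wt0 = 2 * cover_gf G c (covered G c - S) ?wt'"
      by (rule partial_cell_complement[OF cell c two_ratfun_neq_0 cH(2)[OF c] False])
        (use indet indet_neq_0 wtH cH(3)[OF c] S in \<open>force+\<close>)
    then show ?thesis
      using False by simp
  qed
  have state_sub: "\<sigma> c \<subseteq> covered G c" "\<sigma> c \<subseteq> verts H"
    if "\<sigma> \<in> states G \<C> (verts H)" "c \<in> \<C>" for \<sigma> c
  proof -
    show cov: "\<sigma> c \<subseteq> covered G c"
      using that by (auto simp: states_def)
    \<comment> \<open>A vertex chosen in some cell has a nonzero count, and a state allows this only
      for vertices of \<open>H\<close>.\<close>
    show "\<sigma> c \<subseteq> verts H"
    proof
      fix v assume v: "v \<in> \<sigma> c"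
      then have "v \<in> verts G"
        using cov cH(1)[OF that(2)] fin by (auto simp: covered_def finite_graph_def)
      then have "card {c\<in>\<C>. v \<in> \<sigma> c} = of_bool (v \<in> verts H)"
        using that by (simp add: states_def)
      moreover have "card {c\<in>\<C>. v \<in> \<sigma> c} \<noteq> 0"
        using fin\<C> v that by auto
      ultimately show "v \<in> verts H"
        by (simp split: if_splits)
    qed
  qed
  have k: "(\<Prod>c\<in>\<C>. ?k c) =
      2 ^ card (partial_cells G \<C> H) * (\<Prod>c\<in>whole_cells G \<C> H. cell_factor G wt\<^sub>G c)"
    using fin\<C> by (simp add: prod.If_cases whole_cells_def partial_cells_def Int_def mult.commute)
  have "matching_gf H wt\<^sub>H = (\<Sum>\<sigma>\<in>states G \<C> (verts H). \<Prod>c\<in>\<C>. cover_gf G c (\<sigma> c) ?wt0)"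
    by (simp add: matching_gf_subgraph[OF sub] cover_gf_states[OF fin part])
  also have "\<dots> = (\<Sum>\<sigma>\<in>states G \<C> (verts H).
      (\<Prod>c\<in>\<C>. ?k c) * (\<Prod>c\<in>\<C>. cover_gf G c ((\<lambda>c\<in>\<C>. covered G c - \<sigma> c) c) ?wt'))"
    unfolding prod.distrib[symmetric]
    using local state_sub by (intro sum.cong prod.cong refl) simp
  \<comment> \<open>The cell factors do not depend on the state and leave the sum; what remains is
    reindexed by complementing states.\<close>
  also have "\<dots> = (\<Prod>c\<in>\<C>. ?k c) * (\<Sum>\<sigma>\<in>states G \<C> ?W. \<Prod>c\<in>\<C>. cover_gf G c (\<sigma> c) ?wt')"
    unfolding sum_distrib_left[symmetric]
    by (subst sum.reindex_bij_betw[OF bij_betw_states_complement[OF cell HG ext], symmetric]) simp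
  also have "(\<Sum>\<sigma>\<in>states G \<C> ?W. \<Prod>c\<in>\<C>. cover_gf G c (\<sigma> c) ?wt') =
      matching_gf (complement_graph G \<C> H) ?wt'"
  proof -
    have "?W \<subseteq> verts G"
      using HG by (auto simp: extremal_verts_def)
    then show ?thesis
      by (simp add: complement_graph_def matching_gf_induced_subgraph[OF fin] cover_gf_states[OF fin part])
  qed
  finally show ?thesis
    by (simp add: k)
qed

end
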